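(* Let $\alpha > 0$, let $\mathcal{H} = (\mathcal{H}_n)_{n\in\mathbb{N}}$ be a sequence of $3$-uniform hypergraphs with $|V(\mathcal{H}_n)| = n$, and let $\mathcal{B} = (\mathcal{B}_n)_{n \in \mathbb{N}}$ with each $\mathcal{B}_n$ a family of subsets of $V(\mathcal{H}_n)$. Suppose $\mathcal{H}$ is $(\alpha,\mathcal{B})$-stable, $e(\mathcal{H}_n) = \Theta(n^2)$ and $\Delta_2(\mathcal{H}_n) = O(1)$. If $\|\mathcal{B}_n\| \geqslant \alpha n$, then for every $\delta > 0$ there exist $C > 0$ and $\varepsilon = \varepsilon(\mathcal{H},\delta) > 0$ such that, if $m \geqslant C\sqrt{n}$ and $n$ is sufficiently large, then $$\big|\mathrm{SF}^{(\delta)}_{\geqslant}(\mathcal{H}_n,\mathcal{B}_n,m)\big| \leqslant \Big( 2^{-\varepsilon m} + \delta^m |\mathcal{B}_n| \Big)\binom{\|\mathcal{B}_n\|}{m}.$$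
   Context: $|\mathcal{B}_n|$ is the number of sets in $\mathcal{B}_n$ and $\|\mathcal{B}_n\| = \max\{|B| : B \in \mathcal{B}_n\}$. The sequence $\mathcal{H}$ is $(\alpha,\mathcal{B})$-stable if for every $\gamma > 0$ there exists $\beta > 0$ such that for every $n$ and every $A \subseteq V(\mathcal{H}_n)$ with $|A| \geqslant (\alpha-\beta)n$, either $e(\mathcal{H}_n[A]) \geqslant \beta\, e(\mathcal{H}_n)$ or $|A\setminus B| \leqslant \gamma n$ for some $B \in \mathcal{B}_n$ ($e$ = number of edges). $\Delta_2(\mathcal{H}_n)$ is the maximum, over pairs $T$ of vertices, of the number of edges containing $T$. $\mathrm{SF}(\mathcal{H}_n,m)$ is the collection of independent sets (vertex sets containing no edge) of size $m$ in $\mathcal{H}_n$, and $\mathrm{SF}^{(\delta)}_{\geqslant}(\mathcal{H}_n,\mathcal{B}_n,m) = \{I \in \mathrm{SF}(\mathcal{H}_n,m) : |I\setminus B| \geqslant \delta m \text{ for every } B \in \mathcal{B}_n\}$. Asymptotic notation refers to $n\to\infty$. *)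

theory Defs
  imports Complex_Main "HOL-Library.Landau_Symbols"
begin

definition uniform3 :: "'a set \<Rightarrow> 'a set set \<Rightarrow> bool" where
  "uniform3 V E \<longleftrightarrow> finite V \<and> (\<forall>e\<in>E. e \<subseteq> V \<and> card e = 3)"

definition induced_edges :: "'a set set \<Rightarrow> 'a set \<Rightarrow> nat" where
  "induced_edges E A = card {e\<in>E. e \<subseteq> A}"

text \<open>maximum codegree over pairs of vertices (0 if there are no pairs)\<close>
definition Delta2 :: "'a set \<Rightarrow> 'a set set \<Rightarrow> nat" where
  "Delta2 V E = Max (insert 0 ((\<lambda>T. card {e\<in>E. T \<subseteq> e}) ` {T. T \<subseteq> V \<and> card T = 2}))"

text \<open>largest size of a set in the family (0 for the empty family)\<close>
definition fam_norm :: "'a set set \<Rightarrow> nat" where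
  "fam_norm \<B> = Max (insert 0 (card ` \<B>))"

definition stable :: "real \<Rightarrow> (nat \<Rightarrow> 'a set) \<Rightarrow> (nat \<Rightarrow> 'a set set) \<Rightarrow> (nat \<Rightarrow> 'a set set) \<Rightarrow> bool" where
  "stable \<alpha> V E \<B> \<longleftrightarrow>
    (\<forall>\<gamma>>0. \<exists>\<beta>>0. \<forall>n. \<forall>A. A \<subseteq> V n \<and> real (card A) \<ge> (\<alpha> - \<beta>) * real n \<longrightarrow>
        real (induced_edges (E n) A) \<ge> \<beta> * real (card (E n))
      \<or> (\<exists>B\<in>\<B> n. real (card (A - B)) \<le> \<gamma> * real n))"

definition SF :: "'a set \<Rightarrow> 'a set set \<Rightarrow> nat \<Rightarrow> 'a set set" where
  "SF V E m = {I. I \<subseteq> V \<and> card I = m \<and> (\<forall>e\<in>E. \<not> e \<subseteq> I)}"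

definition SF_ge :: "real \<Rightarrow> 'a set \<Rightarrow> 'a set set \<Rightarrow> 'a set set \<Rightarrow> nat \<Rightarrow> 'a set set" where
  "SF_ge \<delta> V E \<B> m = {I \<in> SF V E m. \<forall>B\<in>\<B>. real (card (I - B)) \<ge> \<delta> * real m}"

end

theory Submission
  imports Defs
begin

text \<open>
  Independent sets \<open>I\<close> are covered by few sparse containers, each determined by a fingerprint
  \<open>T \<subseteq> I\<close> with \<open>|T| = O(\<surd>n)\<close>. While the current vertex set \<open>A\<close> is dense, one queries vertices of
  linear degree until about \<open>\<surd>n\<close> of them lie in \<open>I\<close>; their joint link graph then has \<open>\<Omega>(n\<^sup>3\<^sup>/\<^sup>2)\<close>
  edges because codegrees are bounded, so querying its vertices of large degree removes \<open>\<Omega>(n)\<close>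
  vertices from \<open>A\<close> after another \<open>\<surd>n\<close> positive answers. Boundedly many such rounds suffice.

  By stability a sparse container either has at most \<open>(\<alpha> - \<beta>) n\<close> elements, and thus few
  \<open>m\<close>-subsets compared with \<open>N choose m\<close>, where \<open>N = \<parallel>\<B>\<parallel> \<ge> \<alpha> n\<close>, or it has at most \<open>\<gamma> n\<close> elements
  outside some \<open>B \<in> \<B>\<close>. In the second case at least \<open>\<delta> m / 2\<close> elements of \<open>I\<close> come from these \<open>\<gamma> n\<close>
  ones, which is again exponentially rare when \<open>\<gamma>\<close> is small. Since \<open>|T| \<le> \<eta> m\<close> with \<open>\<eta>\<close> small, the
  number of fingerprints does not spoil the exponential gain. The comparison of binomial
  coefficients needs \<open>m \<le> N - \<Omega>(n)\<close>; for larger \<open>m\<close>, stability applied to \<open>I\<close> itself shows that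
  no such \<open>I\<close> exists.
\<close>

section \<open>Containers from decision trees\<close>

text \<open>Triples are ordered, so an edge inside \<open>A\<close> counts six times in
  \<open>triples R A A A\<close>. Degrees, links and joint links are then the same notion, with a
  smaller set in one slot.\<close>

definition triples :: "('a \<Rightarrow> 'a \<Rightarrow> 'a \<Rightarrow> bool) \<Rightarrow> 'a set \<Rightarrow> 'a set \<Rightarrow> 'a set \<Rightarrow> ('a \<times> 'a \<times> 'a) set" where
  "triples R A B C = {(x, y, z). x \<in> A \<and> y \<in> B \<and> z \<in> C \<and> R x y z}"

text \<open>\<open>P\<close> collects the answers given so far and \<open>A\<close> the vertices
  still undecided. \<open>F\<close> is chosen before \<open>I\<close>, so the containers are no more
  numerous than the fingerprints. \<open>T\<close> is added back to \<open>F T\<close> because a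
  selected vertex leaves \<open>A\<close>.\<close>

definition has_containers ::
    "('a set \<Rightarrow> bool) \<Rightarrow> 'a set \<Rightarrow> nat \<Rightarrow> ('a set \<Rightarrow> bool) \<Rightarrow> bool" where
  "has_containers P A s Q \<longleftrightarrow>
    (\<exists>F. \<forall>I. P I \<longrightarrow> (\<exists>T. T \<subseteq> I \<inter> A \<and> finite T \<and> card T \<le> s \<and> I \<inter> A \<subseteq> F T \<union> T \<and> Q (F T)))"

lemma has_containers_leaf: "Q A \<Longrightarrow> has_containers P A s Q"
  unfolding has_containers_def
  by (rule exI[of _ "\<lambda>_. A"]) (auto intro!: exI[of _ "{}"])

lemma has_containers_mono:
  assumes "has_containers P A s Q" and "\<And>I. P' I \<Longrightarrow> P I" and "s \<le> s'"
  shows "has_containers P' A s' Q"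
proof -
  from assms(1) obtain F where
    F: "\<forall>I. P I \<longrightarrow> (\<exists>T. T \<subseteq> I \<inter> A \<and> finite T \<and> card T \<le> s \<and> I \<inter> A \<subseteq> F T \<union> T \<and> Q (F T))"
    unfolding has_containers_def by blast
  show ?thesis
    unfolding has_containers_def
  proof (intro exI[of _ F] allI impI)
    fix I assume "P' I"
    from F[rule_format, OF assms(2)[OF this]] obtain T where
      "T \<subseteq> I \<inter> A" "finite T" "card T \<le> s" "I \<inter> A \<subseteq> F T \<union> T" "Q (F T)"
      by blast
    then show "\<exists>T. T \<subseteq> I \<inter> A \<and> finite T \<and> card T \<le> s' \<and> I \<inter> A \<subseteq> F T \<union> T \<and> Q (F T)"
      using assms(3) by (intro exI[of _ T]) auto
  qed
qed

lemma has_containers_shrink: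
  assumes "has_containers P A' s Q" and "A' \<subseteq> A" and "\<And>I. P I \<Longrightarrow> I \<inter> A \<subseteq> A'"
  shows "has_containers P A s Q"
proof -
  have "I \<inter> A = I \<inter> A'" if "P I" for I
    using assms(2) assms(3)[OF that] by blast
  then show ?thesis
    using assms(1) unfolding has_containers_def by auto
qed

text \<open>The fingerprint records the positive answers only; it still determines the path through
  the decision tree, because a queried vertex lies in the fingerprint iff it lies in \<open>I\<close>.\<close>

lemma has_containers_branch:
  assumes x: "x \<in> A"
    and out: "has_containers (\<lambda>I. P I \<and> x \<notin> I) (A - {x}) (Suc s) Q"
    and "in": "has_containers (\<lambda>I. P I \<and> x \<in> I) (A - {x}) s Q"
  shows "has_containers P A (Suc s) Q"
proof -
  from out obtain F0 where
    F0: "\<And>I. P I \<Longrightarrow> x \<notin> I \<Longrightarrow> \<exists>T. T \<subseteq> I \<inter> (A - {x}) \<and> finite T \<and> card T \<le> Suc s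
          \<and> I \<inter> (A - {x}) \<subseteq> F0 T \<union> T \<and> Q (F0 T)"
    unfolding has_containers_def by auto
  from "in" obtain F1 where
    F1: "\<And>I. P I \<Longrightarrow> x \<in> I \<Longrightarrow> \<exists>T. T \<subseteq> I \<inter> (A - {x}) \<and> finite T \<and> card T \<le> s
          \<and> I \<inter> (A - {x}) \<subseteq> F1 T \<union> T \<and> Q (F1 T)"
    unfolding has_containers_def by auto
  define F where "F T = (if x \<in> T then F1 (T - {x}) else F0 T)" for T
  show ?thesis
    unfolding has_containers_def
  proof (intro exI[of _ F] allI impI)
    fix I assume P: "P I"
    show "\<exists>T. T \<subseteq> I \<inter> A \<and> finite T \<and> card T \<le> Suc s \<and> I \<inter> A \<subseteq> F T \<union> T \<and> Q (F T)"
    proof (cases "x \<in> I")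
      case True
      from F1[OF P True] obtain T where T: "T \<subseteq> I \<inter> (A - {x})" "finite T" "card T \<le> s"
          "I \<inter> (A - {x}) \<subseteq> F1 T \<union> T" "Q (F1 T)" by blast
      have "F (insert x T) = F1 T"
      proof -
        have "insert x T - {x} = T" using T(1) by auto
        then show ?thesis by (simp add: F_def)
      qed
      moreover have "card (insert x T) \<le> Suc s"
        using T by (simp add: card_insert_if)
      ultimately show ?thesis
        using T True x by (intro exI[of _ "insert x T"]) auto
    next
      case False
      from F0[OF P False] obtain T where T: "T \<subseteq> I \<inter> (A - {x})" "finite T" "card T \<le> Suc s"
          "I \<inter> (A - {x}) \<subseteq> F0 T \<union> T" "Q (F0 T)" by blast
      have "F T = F0 T" using T(1) by (auto simp: F_def)
      then show ?thesis
        using T False by (intro exI[of _ T]) auto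
    qed
  qed
qed

section \<open>Double counting in triple systems of bounded codegree\<close>

lemma exists_ge_average:
  fixes f :: "'a \<Rightarrow> nat" and a n :: real
  assumes "finite X" and "real (card X) \<le> n" and "a * n \<le> real (\<Sum>x\<in>X. f x)" and "0 < a" "0 < n"
  shows "\<exists>x\<in>X. a \<le> real (f x)"
proof (rule ccontr)
  assume "\<not> ?thesis"
  then have less: "\<And>x. x \<in> X \<Longrightarrow> real (f x) < a" by force
  have "X \<noteq> {}"
  proof
    assume "X = {}"
    with assms(3) have "a * n \<le> 0" by simp
    with assms(4,5) show False by (simp add: mult_le_0_iff)
  qed
  then have "(\<Sum>x\<in>X. real (f x)) < (\<Sum>x\<in>X. a)"
    using assms(1) less by (intro sum_strict_mono) auto
  also have "\<dots> \<le> a * n"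
    using assms(2,4) by (simp add: mult.commute)
  finally show False
    using assms(3) by simp
qed

text \<open>The two adjacent transpositions generate all permutations of the slots.
  \<open>codeg\<close> covers every pair, including \<open>y = z\<close>, so the counting need not
  treat degenerate pairs separately.\<close>

locale bounded_codegree =
  fixes V :: "'a set" and R :: "'a \<Rightarrow> 'a \<Rightarrow> 'a \<Rightarrow> bool" and D :: nat
  assumes fin: "finite V"
    and sym12: "R x y z \<Longrightarrow> R y x z"
    and sym23: "R x y z \<Longrightarrow> R x z y"
    and codeg: "card {x \<in> V. R x y z} \<le> D"
begin

lemma finite_triples: "A \<subseteq> V \<Longrightarrow> B \<subseteq> V \<Longrightarrow> C \<subseteq> V \<Longrightarrow> finite (triples R A B C)"
  by (rule finite_subset[of _ "V \<times> V \<times> V"]) (auto simp: triples_def fin)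

lemma triples_swap12: "card (triples R A B C) = card (triples R B A C)"
proof (rule bij_betw_same_card, rule bij_betw_byWitness)
  let ?f = "\<lambda>(x, y, z). (y, x, z)"
  show "?f ` triples R A B C \<subseteq> triples R B A C" "?f ` triples R B A C \<subseteq> triples R A B C"
    by (auto simp: triples_def dest: sym12)
qed auto

lemma triples_swap23: "card (triples R A B C) = card (triples R A C B)"
proof (rule bij_betw_same_card, rule bij_betw_byWitness)
  let ?f = "\<lambda>(x, y, z). (x, z, y)"
  show "?f ` triples R A B C \<subseteq> triples R A C B" "?f ` triples R A C B \<subseteq> triples R A B C"
    by (auto simp: triples_def dest: sym23)
qed auto

text \<open>The last two entries leave at most \<open>D\<close> choices for the first.\<close>

lemma card_triples_le:
  assumes "A \<subseteq> V" "B \<subseteq> V" "C \<subseteq> V"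
  shows "card (triples R A B C) \<le> D * (card B * card C)"
proof -
  have "triples R A B C \<subseteq> (\<Union>(y, z)\<in>B \<times> C. (\<lambda>x. (x, y, z)) ` {x \<in> V. R x y z})"
    using assms by (auto simp: triples_def)
  then have "card (triples R A B C) \<le> card (\<Union>(y, z)\<in>B \<times> C. (\<lambda>x. (x, y, z)) ` {x \<in> V. R x y z})"
    using assms fin by (intro card_mono) (auto intro!: finite_UN_I finite_subset[of _ V])
  also have "\<dots> \<le> (\<Sum>(y, z)\<in>B \<times> C. card ((\<lambda>x. (x, y, z)) ` {x \<in> V. R x y z}))"
    using assms fin
    by (intro order_trans[OF card_UN_le]) (auto simp: case_prod_unfold intro: finite_subset[of _ V])
  also have "\<dots> \<le> (\<Sum>(y, z)\<in>B \<times> C. D)"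
    using fin codeg by (intro sum_mono) (auto intro: order_trans[OF card_image_le])
  also have "\<dots> = D * (card B * card C)"
    by (simp add: case_prod_unfold card_cartesian_product)
  finally show ?thesis .
qed

lemma card_triples_eq_sum:
  assumes "A \<subseteq> V" "B \<subseteq> V" "C \<subseteq> V"
  shows "card (triples R A B C) = (\<Sum>x\<in>A. card (triples R {x} B C))"
proof -
  have "triples R A B C = (\<Union>x\<in>A. triples R {x} B C)"
    by (auto simp: triples_def)
  moreover have "card (\<Union>x\<in>A. triples R {x} B C) = (\<Sum>x\<in>A. card (triples R {x} B C))"
  proof (rule card_UN_disjoint)
    show "finite A" using assms(1) fin by (rule finite_subset)
    show "\<forall>x\<in>A. finite (triples R {x} B C)" using assms by (blast intro: finite_triples)
  qed (auto simp: triples_def)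
  ultimately show ?thesis by simp
qed

text \<open>A lost triple has an entry in \<open>A0 - A\<close>. By symmetry each of the three
  positions contributes equally, and a pair with one entry in \<open>A0 - A\<close> extends in at
  most \<open>D\<close> ways.\<close>

lemma card_triples_diff_le:
  assumes "A \<subseteq> A0" "A0 \<subseteq> V"
  shows "card (triples R A0 A0 A0) \<le> card (triples R A A A) + 3 * (D * (card (A0 - A) * card V))"
proof -
  let ?X = "A0 - A"
  have sub: "?X \<subseteq> V" "A \<subseteq> V" using assms by auto
  have le: "card (triples R A0 A0 ?X) \<le> D * (card ?X * card V)"
  proof -
    have "card (triples R A0 A0 ?X) \<le> D * (card A0 * card ?X)"
      using assms sub by (intro card_triples_le) auto
    also have "\<dots> \<le> D * (card V * card ?X)"
      using card_mono[OF fin assms(2)] by (intro mult_le_mono) auto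
    finally show ?thesis by (simp add: mult.commute)
  qed
  have "triples R A0 A0 A0 \<subseteq> triples R A A A \<union> (triples R ?X A0 A0 \<union> (triples R A0 ?X A0 \<union> triples R A0 A0 ?X))"
    by (auto simp: triples_def)
  then have "card (triples R A0 A0 A0)
      \<le> card (triples R A A A \<union> (triples R ?X A0 A0 \<union> (triples R A0 ?X A0 \<union> triples R A0 A0 ?X)))"
    using assms sub by (intro card_mono) (auto intro!: finite_triples)
  also have "\<dots> \<le> card (triples R A A A) + (card (triples R ?X A0 A0)
      + (card (triples R A0 ?X A0) + card (triples R A0 A0 ?X)))"
    by (intro order_trans[OF card_Un_le] add_mono order_refl)
  also have "card (triples R ?X A0 A0) = card (triples R A0 A0 ?X)"
    by (simp add: triples_swap12[of ?X] triples_swap23[of _ ?X])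
  also have "card (triples R A0 ?X A0) = card (triples R A0 A0 ?X)"
    by (simp add: triples_swap23[of _ ?X])
  finally show ?thesis using le by simp
qed

text \<open>With \<open>x\<close> fixed only two positions can meet \<open>A0 - A\<close>, and
  \<open>x\<close> together with such an entry leaves at most \<open>D\<close> choices for the
  third.\<close>

lemma card_link_diff_le:
  assumes "A \<subseteq> A0" "A0 \<subseteq> V" "x \<in> V"
  shows "card (triples R {x} A0 A0) \<le> card (triples R {x} A A) + 2 * (D * card (A0 - A))"
proof -
  let ?X = "A0 - A"
  have sub: "?X \<subseteq> V" "A \<subseteq> V" using assms by auto
  have le: "card (triples R {x} A0 ?X) \<le> D * card ?X"
    using card_triples_le[of A0 "{x}" ?X] assms sub by (simp add: triples_swap12[of "{x}"])
  have "triples R {x} A0 A0 \<subseteq> triples R {x} A A \<union> (triples R {x} ?X A0 \<union> triples R {x} A0 ?X)"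
    by (auto simp: triples_def)
  then have "card (triples R {x} A0 A0)
      \<le> card (triples R {x} A A \<union> (triples R {x} ?X A0 \<union> triples R {x} A0 ?X))"
    using assms sub by (intro card_mono) (auto intro!: finite_triples)
  also have "\<dots> \<le> card (triples R {x} A A) + (card (triples R {x} ?X A0) + card (triples R {x} A0 ?X))"
    by (intro order_trans[OF card_Un_le] add_mono order_refl)
  also have "card (triples R {x} ?X A0) = card (triples R {x} A0 ?X)"
    by (simp add: triples_swap23[of _ ?X])
  finally show ?thesis using le by simp
qed

text \<open>The relation \<open>b = 6 * D * c\<close> is set up so that deleting fewer than
  \<open>c * |V|\<close> vertices destroys at most half of the \<open>b * |V|^2\<close> triples;
  averaging over \<open>A\<close> does the rest. The link is measured in \<open>A0\<close>, not in
  \<open>A\<close>, so that the bound survives later deletions.\<close>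

lemma exists_large_link:
  fixes b c :: real
  assumes "A \<subseteq> A0" "A0 \<subseteq> V" and "V \<noteq> {}" and b: "0 < b" "b = 6 * real D * c"
    and dense: "b * (real (card V))\<^sup>2 \<le> real (card (triples R A0 A0 A0))"
    and few: "real (card (A0 - A)) < c * real (card V)"
  shows "\<exists>x\<in>A. b / 2 * real (card V) \<le> real (card (triples R {x} A0 A0))"
proof -
  let ?n = "real (card V)"
  have n: "?n > 0" using assms(3) fin by (simp add: card_gt_0_iff)
  have sub: "A \<subseteq> V" using assms by auto
  have "real (D * (card (A0 - A) * card V)) \<le> real D * (c * ?n * ?n)"
    unfolding of_nat_mult using few n by (intro mult_left_mono mult_right_mono) auto
  also have "3 * \<dots> = b / 2 * ?n\<^sup>2"
    using b(2) by (simp add: power2_eq_square)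
  finally have "3 * real (D * (card (A0 - A) * card V)) \<le> b / 2 * ?n\<^sup>2" by simp
  moreover have "real (card (triples R A0 A0 A0))
      \<le> real (card (triples R A A A)) + 3 * real (D * (card (A0 - A) * card V))"
    using card_triples_diff_le[OF assms(1,2)] by linarith
  ultimately have "b / 2 * ?n\<^sup>2 \<le> real (card (triples R A A A))"
    using dense by linarith
  then have "(b / 2 * ?n) * ?n \<le> real (\<Sum>x\<in>A. card (triples R {x} A A))"
    using card_triples_eq_sum[OF sub sub sub] by (simp add: power2_eq_square)
  then obtain x where x: "x \<in> A" "b / 2 * ?n \<le> real (card (triples R {x} A A))"
    using exists_ge_average[OF finite_subset[OF sub fin], of ?n "b / 2 * ?n" "\<lambda>x. card (triples R {x} A A)"] card_mono[OF fin sub] n b(1)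
    by auto
  have "card (triples R {x} A A) \<le> card (triples R {x} A0 A0)"
    using assms sub x(1) by (intro card_mono finite_triples) (auto simp: triples_def)
  with x show ?thesis by force
qed

text \<open>Each link had \<open>3 * D * c * |V|\<close> pairs in \<open>A0\<close> and loses at
  most \<open>2 * D * c * |V|\<close> of them, so \<open>D * c * |V|\<close> remain in
  \<open>A\<close>. Averaging over the second entry gives a \<open>y\<close> lying in
  \<open>D * c * |S|\<close> triples. For fixed \<open>y\<close>, each \<open>z\<close> is counted
  by at most \<open>D\<close> elements of \<open>S\<close>, which leaves \<open>c * |S|\<close>
  distinct neighbours.\<close>

lemma exists_many_neighbours:
  fixes b c :: real
  assumes "A \<subseteq> A0" "A0 \<subseteq> V" "S \<subseteq> V" and "V \<noteq> {}" and b: "0 < b" "b = 6 * real D * c"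
    and link: "\<And>x. x \<in> S \<Longrightarrow> b / 2 * real (card V) \<le> real (card (triples R {x} A0 A0))"
    and few: "real (card (A0 - A)) < c * real (card V)" and "S \<noteq> {}"
  shows "\<exists>y\<in>A. c * real (card S) \<le> real (card {z \<in> A. \<exists>x\<in>S. R x y z})"
proof -
  let ?n = "real (card V)"
  have n: "?n > 0" using assms(4) fin by (simp add: card_gt_0_iff)
  have sub: "A \<subseteq> V" using assms by auto
  have D: "real D > 0" and c: "c > 0"
    using b by (auto simp: zero_less_mult_iff)
  have finS: "finite S" using assms(3) fin finite_subset by blast
  have q: "real (card S) > 0" using finS \<open>S \<noteq> {}\<close> by (simp add: card_gt_0_iff)
  have deg: "real D * c * ?n \<le> real (card (triples R {x} A A))" if "x \<in> S" for x
  proof -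
    have "real (card (triples R {x} A0 A0)) \<le> real (card (triples R {x} A A)) + 2 * (real D * real (card (A0 - A)))"
      using card_link_diff_le[OF assms(1,2), of x] that assms(3)
      by (metis (no_types, lifting) of_nat_add of_nat_le_iff of_nat_mult of_nat_numeral subsetD)
    moreover have "real D * real (card (A0 - A)) \<le> real D * (c * ?n)"
      using few by (intro mult_left_mono) auto
    moreover have "b / 2 * ?n = 3 * (real D * (c * ?n))" using b by simp
    ultimately show ?thesis using link[OF that] by linarith
  qed
  have "(real D * c * real (card S)) * ?n = (\<Sum>x\<in>S. real D * c * ?n)" by simp
  also have "\<dots> \<le> (\<Sum>x\<in>S. real (card (triples R {x} A A)))" by (intro sum_mono deg)
  also have "\<dots> = real (card (triples R S A A))"
    using card_triples_eq_sum[OF assms(3) sub sub] by simp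
  also have "card (triples R S A A) = card (triples R A S A)" by (rule triples_swap12)
  also have "\<dots> = (\<Sum>y\<in>A. card (triples R {y} S A))"
    by (rule card_triples_eq_sum[OF sub assms(3) sub])
  finally obtain y where y: "y \<in> A" "real D * c * real (card S) \<le> real (card (triples R {y} S A))"
    using exists_ge_average[OF finite_subset[OF sub fin], of ?n "real D * c * real (card S)"
        "\<lambda>y. card (triples R {y} S A)"]
      card_mono[OF fin sub] n D c q by auto
  let ?N = "{z \<in> A. \<exists>x\<in>S. R x y z}"
  have "card (triples R {y} S A) = card (triples R S {y} A)" by (rule triples_swap12)
  also have "triples R S {y} A = triples R S {y} ?N" by (auto simp: triples_def)
  also have "card \<dots> \<le> D * (card {y} * card ?N)"
    using sub y(1) assms(3) by (intro card_triples_le) auto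
  finally have "real (card (triples R {y} S A)) \<le> real D * real (card ?N)"
    by (simp flip: of_nat_mult)
  with y(2) have "real D * (c * real (card S)) \<le> real D * real (card ?N)" by (simp add: mult.assoc)
  with D have "c * real (card S) \<le> real (card ?N)" by simp
  with y(1) show ?thesis by blast
qed

section \<open>The container algorithm for a symmetric ternary relation\<close>

definition indep :: "'a set \<Rightarrow> bool" where
  "indep I \<longleftrightarrow> (\<forall>x\<in>I. \<forall>y\<in>I. \<forall>z\<in>I. \<not> R x y z)"

text \<open>Once \<open>S \<subseteq> I\<close> is known, selecting \<open>y \<in> I\<close> expels from \<open>I\<close> all neighbours of \<open>y\<close> in the link
  graph of \<open>S\<close>. Some \<open>y\<close> has \<open>c |S|\<close> of them, so \<open>|V| / |S|\<close> selections remove \<open>c |V|\<close> vertices;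
  \<open>k\<close> bounds the number of selections still to be made.\<close>

lemma containers_of_selected:
  fixes b c :: real
  assumes "A0 \<subseteq> V" "S \<subseteq> V" "V \<noteq> {}" and b: "0 < b" "b = 6 * real D * c"
    and link: "\<And>x. x \<in> S \<Longrightarrow> b / 2 * real (card V) \<le> real (card (triples R {x} A0 A0))"
    and "S \<noteq> {}"
    and cont: "\<And>A. A \<subseteq> A0 \<Longrightarrow> c * real (card V) \<le> real (card (A0 - A)) \<Longrightarrow> has_containers indep A s Q"
    and "A \<subseteq> A0"
    and "c * real (card V) \<le> real k * (c * real (card S)) + real (card (A0 - A))"
  shows "has_containers (\<lambda>I. indep I \<and> S \<subseteq> I) A (s + k) Q"
  using assms(9,10)
proof (induction "card A" arbitrary: A k rule: less_induct)
  case less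
  have finA0: "finite A0" using assms(1) fin finite_subset by blast
  show ?case
  proof (cases "c * real (card V) \<le> real (card (A0 - A))")
    case True
    from cont[OF less.prems(1) True] show ?thesis
      by (rule has_containers_mono) auto
  next
    case False
    \<comment> \<open>For \<open>k = 0\<close> the invariant would be the case just
      excluded.\<close>
    then obtain k' where k: "k = Suc k'"
      using less.prems(2) by (cases k) auto
    from False obtain y where y: "y \<in> A" "c * real (card S) \<le> real (card {z \<in> A. \<exists>x\<in>S. R x y z})"
      using exists_many_neighbours[OF less.prems(1) assms(1,2,3) b link _ \<open>S \<noteq> {}\<close>] by auto
    let ?N = "{z \<in> A. \<exists>x\<in>S. R x y z}"
    have finA: "finite A" using finA0 less.prems(1) finite_subset by blast
    have out: "has_containers (\<lambda>I. indep I \<and> S \<subseteq> I) (A - {y}) (s + k) Q"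
    proof (rule less.hyps)
      show "card (A - {y}) < card A" using y(1) finA by (meson card_Diff1_less)
      have "card (A0 - A) \<le> card (A0 - (A - {y}))"
        using finA0 by (intro card_mono) auto
      then show "c * real (card V) \<le> real k * (c * real (card S)) + real (card (A0 - (A - {y})))"
        using less.prems(2) by linarith
    qed (use less.prems(1) in auto)
    have "in": "has_containers (\<lambda>I. indep I \<and> S \<subseteq> I) (A - {y} - ?N) (s + k') Q"
    proof (rule less.hyps)
      show "card (A - {y} - ?N) < card A"
        using y(1) finA by (intro psubset_card_mono) auto
      \<comment> \<open>The neighbours lie in \<open>A\<close>, so they are new deletions: the
        progress \<open>c * |S|\<close> pays for the one selection spent.\<close>
      have "card (A0 - A) + card ?N = card ((A0 - A) \<union> ?N)"
        using finA0 finA by (subst card_Un_disjoint) auto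
      also have "\<dots> \<le> card (A0 - (A - {y} - ?N))"
        using finA0 less.prems(1) by (intro card_mono) auto
      finally have "real (card (A0 - A)) + c * real (card S) \<le> real (card (A0 - (A - {y} - ?N)))"
        using y(2) by linarith
      moreover have "real k * (c * real (card S)) = real k' * (c * real (card S)) + c * real (card S)"
        by (simp add: k algebra_simps)
      ultimately show "c * real (card V) \<le> real k' * (c * real (card S)) + real (card (A0 - (A - {y} - ?N)))"
        using less.prems(2) by linarith
    qed (use less.prems(1) in auto)
    have "has_containers (\<lambda>I. (indep I \<and> S \<subseteq> I) \<and> y \<in> I) (A - {y}) (s + k') Q"
    proof (rule has_containers_shrink)
      show "has_containers (\<lambda>I. (indep I \<and> S \<subseteq> I) \<and> y \<in> I) (A - {y} - ?N) (s + k') Q"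
        using "in" by (rule has_containers_mono) auto
    qed (auto simp: indep_def)
    moreover have "has_containers (\<lambda>I. (indep I \<and> S \<subseteq> I) \<and> y \<notin> I) (A - {y}) (Suc (s + k')) Q"
      using out by (rule has_containers_mono) (auto simp: k)
    ultimately show ?thesis
      using has_containers_branch[OF y(1)] by (simp add: k)
  qed
qed

text \<open>First phase of a round: query vertices of large link until \<open>q\<close> of them have
  been selected, then let \<open>containers_of_selected\<close> finish with \<open>k\<close> further
  selections, which suffice as \<open>k * q\<close> is at least \<open>|V|\<close>. Either phase
  stops once \<open>c * |V|\<close> vertices have left \<open>A0\<close>. Since \<open>S\<close> and
  \<open>A\<close> are disjoint, every selection enlarges \<open>S\<close> and lowers the budget
  \<open>q - card S\<close>.\<close>

lemma containers_of_dense: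
  fixes b c :: real
  assumes "A0 \<subseteq> V" "V \<noteq> {}" and b: "0 < b" "b = 6 * real D * c"
    and dense: "b * (real (card V))\<^sup>2 \<le> real (card (triples R A0 A0 A0))"
    and cont: "\<And>A. A \<subseteq> A0 \<Longrightarrow> c * real (card V) \<le> real (card (A0 - A)) \<Longrightarrow> has_containers indep A s Q"
    and "0 < q" "card V \<le> k * q"
    and "A \<subseteq> A0" "S \<subseteq> V" "S \<inter> A = {}" "card S \<le> q"
    and "\<And>x. x \<in> S \<Longrightarrow> b / 2 * real (card V) \<le> real (card (triples R {x} A0 A0))"
  shows "has_containers (\<lambda>I. indep I \<and> S \<subseteq> I) A (s + k + (q - card S)) Q"
  using assms(9-)
proof (induction "card A" arbitrary: A S rule: less_induct)
  case less
  have finA0: "finite A0" using assms(1) fin finite_subset by blast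
  have finA: "finite A" using finA0 less.prems(1) finite_subset by blast
  have finS: "finite S" using less.prems(2) fin finite_subset by blast
  have c: "c > 0" using b by (auto simp: zero_less_mult_iff)
  show ?case
  proof (cases "c * real (card V) \<le> real (card (A0 - A))")
    case True
    from cont[OF less.prems(1) True] show ?thesis
      by (rule has_containers_mono) auto
  next
    case few: False
    show ?thesis
    proof (cases "card S = q")
      case True
      have "real (card V) \<le> real k * real q" using assms(8) by (metis of_nat_le_iff of_nat_mult)
      then have "c * real (card V) \<le> c * (real k * real q)" using c by simp
      also have "\<dots> = real k * (c * real (card S))" by (simp add: True)
      finally have "c * real (card V) \<le> real k * (c * real (card S)) + real (card (A0 - A))" by simp
      moreover have "S \<noteq> {}" using True assms(7) by auto
      ultimately show ?thesis
        using containers_of_selected[OF assms(1) less.prems(2) assms(2) b less.prems(5) _ cont less.prems(1)]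
        by (simp add: True)
    next
      case False
      then obtain j where j: "q - card S = Suc j" using less.prems(4)
        by (metis Suc_diff_Suc le_neq_implies_less)
      from few obtain x where x: "x \<in> A" "b / 2 * real (card V) \<le> real (card (triples R {x} A0 A0))"
        using exists_large_link[OF less.prems(1) assms(1,2) b dense] by auto
      have smaller: "card (A - {x}) < card A" using x(1) finA by (meson card_Diff1_less)
      have xS: "x \<notin> S" using x(1) less.prems(3) by auto
      have "has_containers (\<lambda>I. indep I \<and> S \<subseteq> I) (A - {x}) (s + k + (q - card S)) Q"
        using less.prems by (intro less.hyps[OF smaller]) auto
      then have out: "has_containers (\<lambda>I. (indep I \<and> S \<subseteq> I) \<and> x \<notin> I) (A - {x}) (Suc (s + k + j)) Q"
        by (rule has_containers_mono) (auto simp: j)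
      have "has_containers (\<lambda>I. indep I \<and> insert x S \<subseteq> I) (A - {x}) (s + k + (q - card (insert x S))) Q"
        using less.prems x assms(1) False finS xS by (intro less.hyps[OF smaller]) auto
      then have "has_containers (\<lambda>I. (indep I \<and> S \<subseteq> I) \<and> x \<in> I) (A - {x}) (s + k + j) Q"
        by (rule has_containers_mono) (use j finS xS in auto)
      from has_containers_branch[OF x(1) out this] show ?thesis by (simp add: j)
    qed
  qed
qed

text \<open>A round on a dense set costs \<open>q + k\<close> selections and removes at least
  \<open>c * |V|\<close> vertices, so \<open>r\<close> bounds the rounds still possible. At
  \<open>r = 0\<close> nothing is left, and the empty set is sparse.\<close>

lemma sparse_containers:
  fixes b c :: real
  assumes "V \<noteq> {}" and b: "0 < b" "b = 6 * real D * c" and q: "0 < q" "card V \<le> k * q"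
    and "A \<subseteq> V" "real (card A) \<le> real r * (c * real (card V))"
  shows "has_containers indep A (r * (q + k))
           (\<lambda>C. C \<subseteq> V \<and> real (card (triples R C C C)) < b * (real (card V))\<^sup>2)"
  using assms(6,7)
proof (induction r arbitrary: A)
  case 0
  then have "A = {}" using fin finite_subset by fastforce
  moreover have "card V > 0" using assms(1) fin by (simp add: card_gt_0_iff)
  moreover have "triples R {} {} {} = {}" by (auto simp: triples_def)
  ultimately show ?case using b(1) by (intro has_containers_leaf) simp
next
  case (Suc r)
  show ?case
  proof (cases "real (card (triples R A A A)) < b * (real (card V))\<^sup>2")
    case True
    with Suc.prems show ?thesis by (intro has_containers_leaf) auto
  next
    case False
    have "has_containers (\<lambda>I. indep I \<and> {} \<subseteq> I) A (r * (q + k) + k + (q - card ({} :: 'a set)))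
           (\<lambda>C. C \<subseteq> V \<and> real (card (triples R C C C)) < b * (real (card V))\<^sup>2)"
    proof (rule containers_of_dense[OF Suc.prems(1) assms(1) b _ _ q])
      fix A' assume A': "A' \<subseteq> A" "c * real (card V) \<le> real (card (A - A'))"
      have "card A = card (A - A') + card A'"
        using A'(1) Suc.prems(1) fin
        by (metis card_Diff_subset card_mono finite_subset le_add_diff_inverse2)
      then have "real (card A') \<le> real r * (c * real (card V))"
        using A'(2) Suc.prems(2) by (simp add: algebra_simps)
      then show "has_containers indep A' (r * (q + k))
           (\<lambda>C. C \<subseteq> V \<and> real (card (triples R C C C)) < b * (real (card V))\<^sup>2)"
        using A'(1) Suc.prems(1) by (intro Suc.IH) auto
    qed (use False in auto)
    then show ?thesis by (rule has_containers_mono) auto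
  qed
qed

end

section \<open>Counting sets inside containers\<close>

lemma Suc_times_choose_Suc: "Suc k * (n choose Suc k) = (n - k) * (n choose k)"
  by (simp only: binomial_absorption binomial_absorb_comp)

text \<open>The quotient is a product of factors \<open>(M - i) / (N - i)\<close>, and subtracting
  the same amount from both terms of a ratio at most 1 does not increase it. Beyond \<open>M\<close>
  the truncated difference is 0.\<close>

lemma choose_le_power_times_choose:
  fixes \<rho> :: real
  assumes "0 \<le> \<rho>" "\<rho> \<le> 1" "real M \<le> \<rho> * real N"
  shows "real (M choose r) \<le> \<rho> ^ r * real (N choose r)"
proof (induction r)
  case (Suc r)
  have "\<rho> * real N \<le> 1 * real N" using assms(2) by (intro mult_right_mono) auto
  with assms(3) have MN: "M \<le> N" by linarith
  have shrink: "real (M - r) \<le> \<rho> * real (N - r)"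
  proof (cases "r \<le> M")
    case True
    have "\<rho> * real r \<le> 1 * real r" using assms(2) by (intro mult_right_mono) auto
    then show ?thesis using True MN assms(3) by (simp add: of_nat_diff algebra_simps)
  qed (use assms(1) in simp)
  have "real (Suc r) * real (M choose Suc r) = real (M - r) * real (M choose r)"
    by (simp only: Suc_times_choose_Suc flip: of_nat_mult)
  also have "\<dots> \<le> (\<rho> * real (N - r)) * (\<rho> ^ r * real (N choose r))"
    using shrink Suc.IH assms(1) by (intro mult_mono) auto
  also have "\<dots> = \<rho> ^ Suc r * (real (N - r) * real (N choose r))" by simp
  also have "real (N - r) * real (N choose r) = real (Suc r) * real (N choose Suc r)"
    by (simp only: Suc_times_choose_Suc flip: of_nat_mult)
  also have "\<rho> ^ Suc r * \<dots> = real (Suc r) * (\<rho> ^ Suc r * real (N choose Suc r))" by (simp only: ac_simps)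
  finally show ?case by (subst (asm) mult_le_cancel_left_pos) auto
qed simp

text \<open>Lowering the bottom index from \<open>k + 1\<close> to \<open>k\<close> costs a factor
  \<open>(k + 1) / (N - k)\<close>; here the numerator is at most \<open>m\<close> and the
  denominator at least the gap \<open>g\<close>.\<close>

lemma choose_diff_le:
  fixes g :: real
  assumes "0 < g" "real m + g \<le> real N" "j \<le> m"
  shows "real (N choose (m - j)) \<le> (real m / g) ^ j * real (N choose m)"
  using assms(3)
proof (induction j)
  case (Suc j)
  define k where "k = m - Suc j"
  have k: "m - j = Suc k" "Suc k \<le> m" using Suc.prems by (auto simp: k_def)
  have g: "g \<le> real (N - k)" using k(2) assms(1,2) by linarith
  have "g * real (N choose k) \<le> real (N - k) * real (N choose k)"
    using g by (intro mult_right_mono) auto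
  also have "\<dots> = real (Suc k) * real (N choose Suc k)"
    by (simp only: Suc_times_choose_Suc flip: of_nat_mult)
  also have "\<dots> \<le> real m * ((real m / g) ^ j * real (N choose m))"
    using k Suc assms(1) by (intro mult_mono) auto
  finally have "real (N choose k) \<le> real m * ((real m / g) ^ j * real (N choose m)) / g"
    using assms(1) by (simp add: field_simps)
  then show ?case by (simp add: k_def)
qed simp

section \<open>Partial sums of the exponential series\<close>

lemma choose_le_power_over_fact: "real (n choose k) \<le> real n ^ k / fact k"
proof -
  have "real ((n choose k) * fact k) \<le> real (n ^ k)"
    using binomial_fact_pow[of n k] by (simp only: of_nat_le_iff)
  then show ?thesis by (simp add: field_simps)
qed

lemma sum_power_over_fact_le_exp:
  fixes y :: real
  assumes "0 \<le> y" "finite S"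
  shows "(\<Sum>k\<in>S. y ^ k / fact k) \<le> exp y"
proof -
  have "(\<Sum>k\<in>S. inverse (fact k) * y ^ k) \<le> (\<Sum>k. inverse (fact k) * y ^ k)"
    using assms summable_exp[of y] by (intro sum_le_suminf) auto
  then show ?thesis
    by (simp add: exp_def divide_inverse mult.commute)
qed

text \<open>This will bound the total weight of the fingerprints. For \<open>t\<close> up to
  \<open>s\<close> one has \<open>x ^ t \<le> L ^ s * (x / L) ^ t\<close> when \<open>L > 1\<close>:
  a large \<open>L\<close> tames the series in \<open>x / L\<close>, and then a small
  \<open>s / m\<close> tames \<open>L ^ s\<close>.\<close>

lemma sum_initial_le_exp:
  fixes b0 \<zeta> :: real
  assumes "0 < b0" "0 < \<zeta>"
  shows "\<exists>\<eta>>0. \<forall>m s. real s \<le> \<eta> * real m \<longrightarrow>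
           (\<Sum>t\<le>s. (real m / b0) ^ t / fact t) \<le> exp (\<zeta> * real m)"
proof -
  \<comment> \<open>The second summand gives \<open>1 / (b0 * L) \<le> \<zeta> / 2\<close>; the 1
    makes \<open>ln L\<close> positive.\<close>
  define L where "L = 1 + 2 / (b0 * \<zeta>)"
  have L: "L > 1" using assms by (simp add: L_def)
  have L0: "L > 0" using L by simp
  show ?thesis
  proof (intro exI[of _ "\<zeta> / (2 * ln L)"] conjI allI impI)
    show "\<zeta> / (2 * ln L) > 0" using assms L by simp
    fix m s :: nat
    assume "real s \<le> \<zeta> / (2 * ln L) * real m"
    then have "real s * ln L \<le> \<zeta> / 2 * real m"
      using L by (simp add: field_simps)
    then have Ls: "L ^ s \<le> exp (\<zeta> / 2 * real m)"
      using L0 by (metis exp_le_cancel_iff exp_ln exp_of_nat_mult)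
    have xL: "real m / b0 / L \<le> \<zeta> / 2 * real m"
    proof -
      have "2 \<le> \<zeta> * (b0 * L)" using assms by (simp add: L_def field_simps)
      then have "1 / (b0 * L) \<le> \<zeta> / 2" using assms L0 by (simp add: field_simps)
      then have "real m * (1 / (b0 * L)) \<le> real m * (\<zeta> / 2)" by (intro mult_left_mono) auto
      then show ?thesis by (simp add: mult.commute)
    qed
    have "(\<Sum>t\<le>s. (real m / b0) ^ t / fact t) \<le> (\<Sum>t\<le>s. L ^ s * ((real m / b0 / L) ^ t / fact t))"
    proof (intro sum_mono)
      fix t assume "t \<in> {..s}"
      then have "L ^ t \<le> L ^ s" using L by (intro power_increasing) auto
      have "(real m / b0) ^ t = L ^ t * (real m / b0 / L) ^ t"
        using L0 by (simp flip: power_mult_distrib)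
      also have "\<dots> \<le> L ^ s * (real m / b0 / L) ^ t"
        using \<open>L ^ t \<le> L ^ s\<close> assms L0 by (intro mult_right_mono) auto
      finally show "(real m / b0) ^ t / fact t \<le> L ^ s * ((real m / b0 / L) ^ t / fact t)"
        by (simp add: divide_right_mono)
    qed
    also have "\<dots> = L ^ s * (\<Sum>t\<le>s. (real m / b0 / L) ^ t / fact t)"
      by (simp add: sum_distrib_left)
    also have "\<dots> \<le> exp (\<zeta> / 2 * real m) * exp (\<zeta> / 2 * real m)"
    proof (intro mult_mono Ls)
      have "(\<Sum>t\<le>s. (real m / b0 / L) ^ t / fact t) \<le> exp (real m / b0 / L)"
        using assms L0 by (intro sum_power_over_fact_le_exp) auto
      then show "(\<Sum>t\<le>s. (real m / b0 / L) ^ t / fact t) \<le> exp (\<zeta> / 2 * real m)"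
        using xL by (meson exp_le_cancel_iff order_trans)
      show "0 \<le> (\<Sum>t\<le>s. (real m / b0 / L) ^ t / fact t)"
        using assms L0 by (intro sum_nonneg) auto
    qed auto
    also have "\<dots> = exp (\<zeta> * real m)" by (simp flip: exp_add)
    finally show "(\<Sum>t\<le>s. (real m / b0) ^ t / fact t) \<le> exp (\<zeta> * real m)" .
  qed
qed

text \<open>For \<open>k\<close> at least \<open>\<delta> * m / 2\<close> the factor
  \<open>exp (- 4 / \<delta>) ^ k\<close> is at most \<open>exp (- 2 * m)\<close>, which beats the
  full series \<open>exp m\<close>.\<close>

lemma sum_tail_le_exp:
  fixes \<delta> :: real
  assumes "0 < \<delta>" "finite S" "\<And>k. k \<in> S \<Longrightarrow> \<delta> / 2 * real m \<le> real k"
  shows "(\<Sum>k\<in>S. (exp (- 4 / \<delta>) * real m) ^ k / fact k) \<le> exp (- real m)"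
proof -
  have "(\<Sum>k\<in>S. (exp (- 4 / \<delta>) * real m) ^ k / fact k) \<le> (\<Sum>k\<in>S. exp (- 2 * real m) * (real m ^ k / fact k))"
  proof (rule sum_mono)
    fix k assume "k \<in> S"
    then have "real k * (- 4 / \<delta>) \<le> - 2 * real m"
      using assms(1) assms(3)[of k] by (simp add: field_simps)
    then have "exp (- 4 / \<delta>) ^ k \<le> exp (- 2 * real m)"
      by (simp flip: exp_of_nat_mult)
    then have "exp (- 4 / \<delta>) ^ k * (real m ^ k / fact k) \<le> exp (- 2 * real m) * (real m ^ k / fact k)"
      by (intro mult_right_mono) auto
    then show "(exp (- 4 / \<delta>) * real m) ^ k / fact k \<le> exp (- 2 * real m) * (real m ^ k / fact k)"
      by (simp add: power_mult_distrib)
  qed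
  also have "\<dots> = exp (- 2 * real m) * (\<Sum>k\<in>S. real m ^ k / fact k)"
    by (simp add: sum_distrib_left)
  also have "\<dots> \<le> exp (- 2 * real m) * exp (real m)"
    using assms(2) by (intro mult_left_mono sum_power_over_fact_le_exp) auto
  also have "\<dots> = exp (- real m)" by (simp flip: exp_add)
  finally show ?thesis .
qed

section \<open>Counting inside one container, then over all fingerprints\<close>

lemma card_subsets_split_le:
  assumes "finite C"
  shows "card {J. J \<subseteq> C \<and> card J = r \<and> d \<le> real (card (J - B))}
    \<le> (\<Sum>k\<in>{k. k \<le> r \<and> d \<le> real k}. (card (C - B) choose k) * (card (C \<inter> B) choose (r - k)))"
proof -
  let ?J = "{J. J \<subseteq> C \<and> card J = r \<and> d \<le> real (card (J - B))}"
  let ?K = "{k. k \<le> r \<and> d \<le> real k}"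
  let ?P = "\<lambda>k. {X. X \<subseteq> C - B \<and> card X = k} \<times> {Y. Y \<subseteq> C \<inter> B \<and> card Y = r - k}"
  have finP: "finite (?P k)" for k
    using assms by (intro finite_cartesian_product) (auto intro: finite_subset[of _ "Pow C"])
  have finK: "finite ?K" by (rule finite_subset[of _ "{..r}"]) auto
  have "inj_on (\<lambda>J. (J - B, J \<inter> B)) ?J"
    by (rule inj_onI) (metis Int_Diff_Un Pair_inject)
  moreover have "(\<lambda>J. (J - B, J \<inter> B)) ` ?J \<subseteq> (\<Union>k\<in>?K. ?P k)"
  proof
    fix p assume "p \<in> (\<lambda>J. (J - B, J \<inter> B)) ` ?J"
    then obtain J where J: "J \<subseteq> C" "card J = r" "d \<le> real (card (J - B))" "p = (J - B, J \<inter> B)"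
      by blast
    have "finite J" using J(1) assms finite_subset by blast
    then have "card (J - B) + card (J \<inter> B) = r"
      using J(2) by (metis Int_commute add.commute card_Diff_subset_Int card_mono finite_Int inf_le1 le_add_diff_inverse)
    with J show "p \<in> (\<Union>k\<in>?K. ?P k)"
      by (intro UN_I[of "card (J - B)"]) auto
  qed
  ultimately have "card ?J \<le> card (\<Union>k\<in>?K. ?P k)"
    using finK finP by (intro card_inj_on_le) auto
  also have "\<dots> \<le> (\<Sum>k\<in>?K. card (?P k))"
    by (rule card_UN_le[OF finK])
  also have "\<dots> = (\<Sum>k\<in>?K. (card (C - B) choose k) * (card (C \<inter> B) choose (r - k)))"
    unfolding card_cartesian_product
    using n_subsets[of "C - B"] n_subsets[of "C \<inter> B"] assms by (simp del: Int_subset_iff le_inf_iff)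
  finally show ?thesis .
qed

lemma card_supersets_le:
  assumes "finite C" "finite T" and "\<And>I. I \<in> \<I> \<Longrightarrow> T \<subseteq> I \<and> I \<subseteq> C \<union> T"
    and "\<And>I. I \<in> \<I> \<Longrightarrow> P (I - T)"
  shows "card \<I> \<le> card {J. J \<subseteq> C \<and> P J}"
proof (rule card_inj_on_le)
  show "inj_on (\<lambda>I. I - T) \<I>"
  proof (rule inj_onI)
    fix I I' assume "I \<in> \<I>" "I' \<in> \<I>" "I - T = I' - T"
    then show "I = I'" using assms(3)[of I] assms(3)[of I'] by blast
  qed
  show "(\<lambda>I. I - T) ` \<I> \<subseteq> {J. J \<subseteq> C \<and> P J}"
    using assms(3,4) by blast
  show "finite {J. J \<subseteq> C \<and> P J}"
    using assms(1) by (auto intro: finite_subset[of _ "Pow C"])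
qed

text \<open>As \<open>N \<le> n\<close>, the container has at most \<open>(1 - \<beta>) * N\<close>
  elements, which gains \<open>(1 - \<beta>) ^ (m - card T)\<close>; at least \<open>m / 2\<close>
  factors remain. Returning from \<open>m - card T\<close> to \<open>m\<close> in the binomial costs
  one factor \<open>m / (b0 * n)\<close> per element of \<open>T\<close>, with \<open>b0 * n\<close>
  as the gap.\<close>

lemma card_small_container_le:
  fixes \<beta> b0 :: real
  assumes "finite C" "finite T" and \<I>: "\<And>I. I \<in> \<I> \<Longrightarrow> T \<subseteq> I \<and> I \<subseteq> C \<union> T \<and> card I = m"
    and b: "0 < \<beta>" "\<beta> \<le> 1" "0 < b0" and n: "0 < n" "N \<le> n"
    and small: "real (card C) + \<beta> * real n \<le> real N"
    and m: "real m + b0 * real n \<le> real N" and T: "2 * card T \<le> m"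
  shows "real (card \<I>) \<le> exp (- \<beta> / 2 * real m) * (real m / (b0 * real n)) ^ card T * real (N choose m)"
proof -
  let ?t = "card T"
  have "card \<I> \<le> card {J. J \<subseteq> C \<and> card J = m - ?t}"
    using assms(1,2) \<I> by (intro card_supersets_le[of C T]) (auto simp: card_Diff_subset)
  also have "\<dots> = card C choose (m - ?t)"
    using assms(1) by (simp add: n_subsets)
  finally have "real (card \<I>) \<le> real (card C choose (m - ?t))" by simp
  also have "\<dots> \<le> (1 - \<beta>) ^ (m - ?t) * real (N choose (m - ?t))"
  proof (rule choose_le_power_times_choose)
    have "\<beta> * real N \<le> \<beta> * real n" using b n by (intro mult_left_mono) auto
    then show "real (card C) \<le> (1 - \<beta>) * real N" using small by (simp add: algebra_simps)
  qed (use b in auto)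
  also have "\<dots> \<le> exp (- \<beta> / 2 * real m) * ((real m / (b0 * real n)) ^ ?t * real (N choose m))"
  proof (rule mult_mono)
    have "(1 - \<beta>) ^ (m - ?t) \<le> exp (- \<beta>) ^ (m - ?t)"
      using b exp_ge_add_one_self[of "- \<beta>"] by (intro power_mono) auto
    also have "\<dots> = exp (- (\<beta> * real (m - ?t)))" by (simp add: mult.commute flip: exp_of_nat_mult)
    also have "\<dots> \<le> exp (- \<beta> / 2 * real m)"
    proof -
      have "\<beta> * (real m / 2) \<le> \<beta> * real (m - ?t)"
        using b T by (intro mult_left_mono) auto
      then show ?thesis by simp
    qed
    finally show "(1 - \<beta>) ^ (m - ?t) \<le> exp (- \<beta> / 2 * real m)" .
    show "real (N choose (m - ?t)) \<le> (real m / (b0 * real n)) ^ ?t * real (N choose m)"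
      using b n m T by (intro choose_diff_le) auto
  qed (use b in auto)
  finally show ?thesis by (simp add: mult.assoc)
qed

text \<open>After removing \<open>T\<close>, at least \<open>\<delta> * m / 2\<close> elements still
  lie outside \<open>B\<close>; let \<open>k\<close> be their number. They are chosen from few
  vertices, and the others from at most \<open>N\<close>.\<close>

lemma card_structured_container_le:
  fixes \<delta> b0 :: real
  assumes "finite C" "finite T" and \<I>: "\<And>I. I \<in> \<I> \<Longrightarrow> T \<subseteq> I \<and> I \<subseteq> C \<union> T \<and> card I = m"
    and far: "\<And>I. I \<in> \<I> \<Longrightarrow> \<delta> * real m \<le> real (card (I - B))"
    and b: "0 < \<delta>" "0 < b0" and n: "0 < n" and B: "finite B" "card B \<le> N"
    and close: "real (card (C - B)) \<le> b0 * exp (- 4 / \<delta>) * real n"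
    and m: "real m + b0 * real n \<le> real N" and T: "2 * card T \<le> m" "real (card T) \<le> \<delta> / 2 * real m"
  shows "real (card \<I>) \<le> exp (- real m) * (real m / (b0 * real n)) ^ card T * real (N choose m)"
proof -
  let ?t = "card T" and ?\<rho> = "real m / (b0 * real n)"
  let ?r = "m - card T" and ?d = "\<delta> / 2 * real m"
  let ?K = "{k. k \<le> ?r \<and> ?d \<le> real k}"
  have finK: "finite ?K" by (rule finite_subset[of _ "{..?r}"]) auto
  have \<rho>: "0 \<le> ?\<rho>" using b by simp
  have "card \<I> \<le> card {J. J \<subseteq> C \<and> (card J = ?r \<and> ?d \<le> real (card (J - B)))}"
  proof (rule card_supersets_le[OF assms(1,2)])
    fix I assume I: "I \<in> \<I>"
    show "T \<subseteq> I \<and> I \<subseteq> C \<union> T" using \<I>[OF I] by blast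
    have finI: "finite I" using \<I>[OF I] assms(1,2) by (meson finite_UnI finite_subset)
    have "card (I - B) \<le> card ((I - T - B) \<union> T)"
      using finI assms(2) by (intro card_mono) auto
    also have "\<dots> \<le> card (I - T - B) + card T" by (rule card_Un_le)
    finally have "?d \<le> real (card (I - T - B))" using far[OF I] T(2) by linarith
    then show "card (I - T) = ?r \<and> ?d \<le> real (card (I - T - B))"
      using \<I>[OF I] assms(2) by (simp add: card_Diff_subset)
  qed
  also have "\<dots> \<le> (\<Sum>k\<in>?K. (card (C - B) choose k) * (card (C \<inter> B) choose (?r - k)))"
    by (rule card_subsets_split_le[OF assms(1)])
  finally have "real (card \<I>) \<le> (\<Sum>k\<in>?K. real (card (C - B) choose k) * real (card (C \<inter> B) choose (?r - k)))"
    by (metis (no_types, lifting) of_nat_le_iff of_nat_mult of_nat_sum sum.cong)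
  also have "\<dots> \<le> (\<Sum>k\<in>?K. (exp (- 4 / \<delta>) * real m) ^ k / fact k * (?\<rho> ^ ?t * real (N choose m)))"
  proof (rule sum_mono)
    fix k assume k: "k \<in> ?K"
    have "real (card (C - B) choose k) \<le> real (card (C - B)) ^ k / fact k"
      by (rule choose_le_power_over_fact)
    also have "\<dots> \<le> (b0 * exp (- 4 / \<delta>) * real n) ^ k / fact k"
      using close by (intro divide_right_mono power_mono) auto
    finally have 1: "real (card (C - B) choose k) \<le> (b0 * exp (- 4 / \<delta>) * real n) ^ k / fact k" .
    have "card (C \<inter> B) \<le> N" using B card_mono[of B "C \<inter> B"] by auto
    then have "real (card (C \<inter> B) choose (?r - k)) \<le> real (N choose (m - (?t + k)))"
      by (simp add: binomial_right_mono)
    also have "\<dots> \<le> ?\<rho> ^ (?t + k) * real (N choose m)"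
      using b n m T k by (intro choose_diff_le) auto
    finally have 2: "real (card (C \<inter> B) choose (?r - k)) \<le> ?\<rho> ^ (?t + k) * real (N choose m)" .
    have "real (card (C - B) choose k) * real (card (C \<inter> B) choose (?r - k))
        \<le> (b0 * exp (- 4 / \<delta>) * real n) ^ k / fact k * (?\<rho> ^ (?t + k) * real (N choose m))"
      using 1 2 b by (intro mult_mono) auto
    also have "\<dots> = ((b0 * exp (- 4 / \<delta>) * real n) * ?\<rho>) ^ k / fact k * (?\<rho> ^ ?t * real (N choose m))"
      unfolding power_add power_mult_distrib[of "b0 * exp (- 4 / \<delta>) * real n" ?\<rho>] times_divide_eq_left
      by (simp only: ac_simps)
    \<comment> \<open>The gap \<open>b0 * n\<close> cancels, which is why the bound on
      \<open>C - B\<close> carries the factor \<open>b0\<close>.\<close>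
    also have "(b0 * exp (- 4 / \<delta>) * real n) * ?\<rho> = exp (- 4 / \<delta>) * real m"
      using b n by simp
    finally show "real (card (C - B) choose k) * real (card (C \<inter> B) choose (?r - k))
        \<le> (exp (- 4 / \<delta>) * real m) ^ k / fact k * (?\<rho> ^ ?t * real (N choose m))" .
  qed
  also have "\<dots> = (\<Sum>k\<in>?K. (exp (- 4 / \<delta>) * real m) ^ k / fact k) * (?\<rho> ^ ?t * real (N choose m))"
    by (simp only: sum_distrib_right)
  also have "\<dots> \<le> exp (- real m) * (?\<rho> ^ ?t * real (N choose m))"
    using b \<rho> finK by (intro mult_right_mono sum_tail_le_exp) auto
  finally show ?thesis by (simp add: mult.assoc)
qed

text \<open>A union bound by fingerprint size. The factor \<open>\<rho> ^ card T\<close> offsets the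
  roughly \<open>|V| ^ t / t!\<close> choices of a fingerprint of size \<open>t\<close>.\<close>

lemma card_Union_fingerprints_le:
  fixes w \<rho> :: real
  assumes "finite V" "0 \<le> w" "0 \<le> \<rho>"
    and cover: "\<And>I. I \<in> \<I> \<Longrightarrow> \<exists>T. T \<subseteq> V \<and> card T \<le> s \<and> I \<in> G T"
    and le: "\<And>T. T \<subseteq> V \<Longrightarrow> card T \<le> s \<Longrightarrow> real (card (G T)) \<le> w * \<rho> ^ card T"
    and fin: "\<And>T. finite (G T)"
  shows "real (card \<I>) \<le> w * (\<Sum>t\<le>s. (real (card V) * \<rho>) ^ t / fact t)"
proof -
  let ?X = "\<lambda>t. {T. T \<subseteq> V \<and> card T = t}"
  have finX: "finite (?X t)" for t
    using assms(1) by (auto intro: finite_subset[of _ "Pow V"])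
  have "\<I> \<subseteq> (\<Union>t\<le>s. \<Union>T\<in>?X t. G T)"
  proof
    fix I assume "I \<in> \<I>"
    from cover[OF this] obtain T where "T \<subseteq> V" "card T \<le> s" "I \<in> G T" by blast
    then show "I \<in> (\<Union>t\<le>s. \<Union>T\<in>?X t. G T)"
      by (intro UN_I[of "card T"] UN_I[of T]) auto
  qed
  then have "card \<I> \<le> card (\<Union>t\<le>s. \<Union>T\<in>?X t. G T)"
    using finX fin by (intro card_mono) auto
  also have "\<dots> \<le> (\<Sum>t\<le>s. card (\<Union>T\<in>?X t. G T))" by (intro card_UN_le) auto
  also have "\<dots> \<le> (\<Sum>t\<le>s. \<Sum>T\<in>?X t. card (G T))" by (intro sum_mono card_UN_le finX)
  finally have "real (card \<I>) \<le> real (\<Sum>t\<le>s. \<Sum>T\<in>?X t. card (G T))"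
    by (simp only: of_nat_le_iff)
  also have "\<dots> = (\<Sum>t\<le>s. \<Sum>T\<in>?X t. real (card (G T)))" by simp
  also have "\<dots> \<le> (\<Sum>t\<le>s. \<Sum>T\<in>?X t. w * \<rho> ^ t)"
    using le by (intro sum_mono) auto
  also have "\<dots> = (\<Sum>t\<le>s. real (card V choose t) * (w * \<rho> ^ t))"
    using assms(1) by (simp add: n_subsets)
  also have "\<dots> \<le> (\<Sum>t\<le>s. real (card V) ^ t / fact t * (w * \<rho> ^ t))"
    using assms(2,3) by (intro sum_mono mult_right_mono choose_le_power_over_fact) auto
  also have "\<dots> = w * (\<Sum>t\<le>s. (real (card V) * \<rho>) ^ t / fact t)"
    by (simp add: sum_distrib_left power_mult_distrib ac_simps)
  finally show ?thesis .
qed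

section \<open>Stable 3-uniform hypergraphs\<close>

lemma uniform3_finite: "uniform3 V E \<Longrightarrow> finite V" "uniform3 V E \<Longrightarrow> finite E"
  by (auto simp: uniform3_def intro: finite_subset[of E "Pow V"])

lemma codegree_le_Delta2:
  assumes "uniform3 V E" "T \<subseteq> V" "card T = 2"
  shows "card {e \<in> E. T \<subseteq> e} \<le> Delta2 V E"
  unfolding Delta2_def
proof (rule Max_ge)
  show "finite (insert 0 ((\<lambda>T. card {e \<in> E. T \<subseteq> e}) ` {T. T \<subseteq> V \<and> card T = 2}))"
    using uniform3_finite(1)[OF assms(1)] by (auto intro!: finite_subset[of _ "Pow V"])
qed (use assms in auto)

lemma card_le_fam_norm:
  assumes "finite \<B>" "B \<in> \<B>"
  shows "card B \<le> fam_norm \<B>"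
  unfolding fam_norm_def using assms by (intro Max_ge) auto

lemma fam_norm_le:
  assumes "finite V" "\<B> \<subseteq> Pow V"
  shows "fam_norm \<B> \<le> card V"
  unfolding fam_norm_def using assms finite_subset[OF assms(2)] by (auto intro!: Max.boundedI card_mono)

lemma uniform3_edge_distinct:
  assumes "uniform3 V E" "{x, y, z} \<in> E"
  shows "x \<noteq> y" "x \<noteq> z" "y \<noteq> z" "x \<in> V" "y \<in> V" "z \<in> V"
proof -
  have c: "card {x, y, z} = 3" and "{x, y, z} \<subseteq> V" using assms by (auto simp: uniform3_def)
  then show "x \<in> V" "y \<in> V" "z \<in> V" by auto
  show "x \<noteq> y" "x \<noteq> z" "y \<noteq> z" using c by (auto simp: card_insert_if split: if_splits)
qed

text \<open>If some \<open>x\<close> completes \<open>y\<close>, \<open>z\<close> to an edge, then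
  \<open>y\<close> and \<open>z\<close> are distinct vertices and \<open>Delta2\<close> applies;
  otherwise the set is empty.\<close>

lemma bounded_codegree_uniform3:
  assumes u: "uniform3 V E" and D: "Delta2 V E \<le> D"
  shows "bounded_codegree V (\<lambda>x y z. {x, y, z} \<in> E) D"
proof
  fix x y z
  show "finite V" using u by (rule uniform3_finite)
  show "{x, y, z} \<in> E \<Longrightarrow> {y, x, z} \<in> E" "{x, y, z} \<in> E \<Longrightarrow> {x, z, y} \<in> E"
    by (simp_all add: insert_commute)
  show "card {x \<in> V. {x, y, z} \<in> E} \<le> D"
  proof (cases "{x \<in> V. {x, y, z} \<in> E} = {}")
    case True
    show ?thesis by (simp only: True card.empty le0)
  next
    case False
    then have yz: "y \<noteq> z" "y \<in> V" "z \<in> V" using uniform3_edge_distinct[OF u] by blast+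
    have "card {x \<in> V. {x, y, z} \<in> E} \<le> card {e \<in> E. {y, z} \<subseteq> e}"
    proof (rule card_inj_on_le)
      show "inj_on (\<lambda>x. {x, y, z}) {x \<in> V. {x, y, z} \<in> E}"
      proof (rule inj_onI)
        fix a b assume "a \<in> {x \<in> V. {x, y, z} \<in> E}" "b \<in> {x \<in> V. {x, y, z} \<in> E}" "{a, y, z} = {b, y, z}"
        moreover from this have "a \<noteq> y" "a \<noteq> z" using uniform3_edge_distinct[OF u, of a y z] by auto
        ultimately show "a = b" by auto
      qed
      show "finite {e \<in> E. {y, z} \<subseteq> e}" using uniform3_finite(2)[OF u] by simp
    qed auto
    also have "\<dots> \<le> Delta2 V E" using yz by (intro codegree_le_Delta2[OF u]) auto
    finally show ?thesis using D by simp
  qed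
qed

lemma induced_edges_le_triples:
  assumes "uniform3 V E" "A \<subseteq> V"
  shows "induced_edges E A \<le> card (triples (\<lambda>x y z. {x, y, z} \<in> E) A A A)"
  unfolding induced_edges_def
proof (rule surj_card_le[of _ _ "\<lambda>(x, y, z). {x, y, z}"])
  have "finite A" using assms uniform3_finite(1) finite_subset by blast
  then show "finite (triples (\<lambda>x y z. {x, y, z} \<in> E) A A A)"
    by (auto simp: triples_def intro: finite_subset[of _ "A \<times> A \<times> A"])
  show "{e \<in> E. e \<subseteq> A} \<subseteq> (\<lambda>(x, y, z). {x, y, z}) ` triples (\<lambda>x y z. {x, y, z} \<in> E) A A A"
  proof
    fix e assume e: "e \<in> {e \<in> E. e \<subseteq> A}"
    then have "card e = 3" using assms(1) by (auto simp: uniform3_def)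
    then obtain x y z where "e = {x, y, z}" by (auto simp: card_3_iff)
    with e show "e \<in> (\<lambda>(x, y, z). {x, y, z}) ` triples (\<lambda>x y z. {x, y, z} \<in> E) A A A"
      by (intro image_eqI[of _ _ "(x, y, z)"]) (auto simp: triples_def)
  qed
qed

text \<open>Taking \<open>k = q\<close>, about the square root of \<open>|V|\<close>, balances
  \<open>q + k\<close> against \<open>k * q \<ge> |V|\<close>, and \<open>r \<ge> 1 / c\<close>
  rounds exhaust \<open>V\<close>. So \<open>K = 4 * r\<close> depends on \<open>b\<close> and
  \<open>D\<close> only.\<close>

lemma hypergraph_containers:
  fixes b :: real and D :: nat
  assumes "0 < b" "0 < D"
  shows "\<exists>K>0. \<forall>(V :: 'a set) E. uniform3 V E \<and> Delta2 V E \<le> D \<and> V \<noteq> {} \<longrightarrow>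
    (\<exists>F s. real s \<le> K * sqrt (real (card V)) \<and>
      (\<forall>I. I \<subseteq> V \<and> (\<forall>e\<in>E. \<not> e \<subseteq> I) \<longrightarrow> (\<exists>T. T \<subseteq> I \<and> card T \<le> s \<and> I \<subseteq> F T \<union> T \<and>
         F T \<subseteq> V \<and> real (induced_edges E (F T)) < b * (real (card V))\<^sup>2)))"
proof -
  define c where "c = b / (6 * real D)"
  define r where "r = nat \<lceil>1 / c\<rceil>"
  have c: "c > 0" "b = 6 * real D * c" using assms by (auto simp: c_def)
  have r: "1 \<le> real r * c"
  proof -
    have "1 / c \<le> real r" unfolding r_def by (rule real_nat_ceiling_ge)
    then show ?thesis using c by (simp add: field_simps)
  qed
  have "r > 0" using r by (cases r) auto
  show ?thesis
  proof (intro exI[of _ "4 * real r"] conjI allI impI)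
    show "4 * real r > 0" using \<open>r > 0\<close> by simp
    fix V :: "'a set" and E
    assume VE: "uniform3 V E \<and> Delta2 V E \<le> D \<and> V \<noteq> {}"
    let ?n = "real (card V)" and ?R = "\<lambda>x y z. {x, y, z} \<in> E"
    interpret bounded_codegree V ?R D
      using VE by (intro bounded_codegree_uniform3) auto
    have n: "?n \<ge> 1" using VE fin by (simp add: Suc_le_eq card_gt_0_iff)
    define q where "q = nat \<lceil>sqrt ?n\<rceil>"
    have q1: "sqrt ?n \<le> real q" unfolding q_def by (rule real_nat_ceiling_ge)
    have q2: "real q \<le> 2 * sqrt ?n"
    proof -
      have "real q \<le> sqrt ?n + 1"
        unfolding q_def using real_sqrt_ge_zero[of ?n] by linarith
      moreover have "1 \<le> sqrt ?n" using n by simp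
      ultimately show ?thesis by linarith
    qed
    have "?n = sqrt ?n * sqrt ?n" by simp
    also have "\<dots> \<le> real q * real q" using q1 by (intro mult_mono) auto
    finally have qq: "card V \<le> q * q" by (simp flip: of_nat_mult)
    have q0: "q > 0" using qq n by (cases q) auto
    have "has_containers indep V (r * (q + q))
           (\<lambda>C. C \<subseteq> V \<and> real (card (triples ?R C C C)) < b * ?n\<^sup>2)"
    proof (rule sparse_containers[OF _ assms(1) c(2) q0 qq])
      have "1 * ?n \<le> (real r * c) * ?n" using r by (intro mult_right_mono) auto
      then show "?n \<le> real r * (c * ?n)" by (simp add: mult.assoc)
    qed (use VE in auto)
    then obtain F where F: "\<And>I. indep I \<Longrightarrow> \<exists>T. T \<subseteq> I \<inter> V \<and> finite T \<and> card T \<le> r * (q + q)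
        \<and> I \<inter> V \<subseteq> F T \<union> T \<and> F T \<subseteq> V \<and> real (card (triples ?R (F T) (F T) (F T))) < b * ?n\<^sup>2"
      unfolding has_containers_def by auto
    show "\<exists>F s. real s \<le> 4 * real r * sqrt ?n \<and>
      (\<forall>I. I \<subseteq> V \<and> (\<forall>e\<in>E. \<not> e \<subseteq> I) \<longrightarrow> (\<exists>T. T \<subseteq> I \<and> card T \<le> s \<and> I \<subseteq> F T \<union> T \<and>
         F T \<subseteq> V \<and> real (induced_edges E (F T)) < b * ?n\<^sup>2))"
    proof (intro exI[of _ F] exI[of _ "r * (q + q)"] conjI allI impI)
      have "real r * (real q + real q) \<le> real r * (4 * sqrt ?n)"
        using q2 by (intro mult_left_mono) auto
      then show "real (r * (q + q)) \<le> 4 * real r * sqrt ?n" by simp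
      fix I assume I: "I \<subseteq> V \<and> (\<forall>e\<in>E. \<not> e \<subseteq> I)"
      have "indep I"
        unfolding indep_def
      proof (intro ballI notI)
        fix x y z assume "x \<in> I" "y \<in> I" "z \<in> I" "{x, y, z} \<in> E"
        moreover from this have "{x, y, z} \<subseteq> I" by simp
        ultimately show False using I by blast
      qed
      from F[OF this] obtain T where T: "T \<subseteq> I \<inter> V" "card T \<le> r * (q + q)" "I \<inter> V \<subseteq> F T \<union> T"
        "F T \<subseteq> V" "real (card (triples ?R (F T) (F T) (F T))) < b * ?n\<^sup>2" by blast
      have "induced_edges E (F T) \<le> card (triples ?R (F T) (F T) (F T))"
        using VE T(4) by (intro induced_edges_le_triples) auto
      with T I show "\<exists>T. T \<subseteq> I \<and> card T \<le> r * (q + q) \<and> I \<subseteq> F T \<union> T \<and>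
         F T \<subseteq> V \<and> real (induced_edges E (F T)) < b * ?n\<^sup>2"
        by (intro exI[of _ T]) auto
    qed
  qed
qed

text \<open>Containers of both kinds hold at most \<open>w * \<rho> ^ card T\<close> of the sets,
  where \<open>w\<close> carries the gain \<open>exp (- \<beta> * m / 2)\<close>. Summing over
  fingerprints costs \<open>exp (\<beta> * m / 4)\<close>, so half of the exponent survives.\<close>

lemma card_SF_ge_le:
  fixes \<delta> \<beta> b0 :: real
  assumes V: "finite V" "V \<noteq> {}" and \<B>: "\<B> \<subseteq> Pow V"
    and pos: "0 < \<delta>" "0 < \<beta>" "\<beta> \<le> 1" "0 < b0"
    and s: "2 * s \<le> m" "real s \<le> \<delta> / 2 * real m"
    and cont: "\<And>I. I \<subseteq> V \<Longrightarrow> \<forall>e\<in>E. \<not> e \<subseteq> I \<Longrightarrow> \<exists>T. T \<subseteq> I \<and> card T \<le> s \<and> I \<subseteq> F T \<union> T \<and> F T \<subseteq> V \<and> sparse (F T)"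
    and dich: "\<And>C. C \<subseteq> V \<Longrightarrow> sparse C \<Longrightarrow> real (card C) + \<beta> * real (card V) \<le> real (fam_norm \<B>)
        \<or> (\<exists>B\<in>\<B>. real (card (C - B)) \<le> b0 * exp (- 4 / \<delta>) * real (card V))"
    and m: "real m + b0 * real (card V) \<le> real (fam_norm \<B>)"
    and sum: "(\<Sum>t\<le>s. (real m / b0) ^ t / fact t) \<le> exp (\<beta> / 4 * real m)"
  shows "real (card (SF_ge \<delta> V E \<B> m)) \<le> exp (- \<beta> / 4 * real m) * real (fam_norm \<B> choose m)"
proof -
  let ?N = "fam_norm \<B>" and ?n = "card V"
  define \<rho> where "\<rho> = real m / (b0 * real ?n)"
  define w where "w = exp (- \<beta> / 2 * real m) * real (?N choose m)"
  \<comment> \<open>\<open>F\<close> is uncontrolled off genuine fingerprints; the last two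
    conditions make \<open>G T\<close> empty wherever \<open>F T\<close> is not a sparse subset of
    \<open>V\<close>.\<close>
  define G where "G T = {I \<in> SF_ge \<delta> V E \<B> m. T \<subseteq> I \<and> I \<subseteq> F T \<union> T \<and> F T \<subseteq> V \<and> sparse (F T)}" for T
  have n: "0 < ?n" using V by (simp add: card_gt_0_iff)
  have fin\<B>: "finite \<B>" using \<B> V(1) by (meson finite_Pow_iff finite_subset)
  have "real (card (SF_ge \<delta> V E \<B> m)) \<le> w * (\<Sum>t\<le>s. (real ?n * \<rho>) ^ t / fact t)"
  proof (rule card_Union_fingerprints_le[OF V(1)])
    show "0 \<le> w" "0 \<le> \<rho>" using pos by (auto simp: w_def \<rho>_def)
    show "finite (G T)" for T
      using V(1) by (intro finite_subset[of "G T" "Pow V"]) (auto simp: G_def SF_ge_def SF_def)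
    fix I assume I: "I \<in> SF_ge \<delta> V E \<B> m"
    then have "I \<subseteq> V" "\<forall>e\<in>E. \<not> e \<subseteq> I" by (auto simp: SF_ge_def SF_def)
    from cont[OF this] obtain T where "T \<subseteq> I" "card T \<le> s" "I \<subseteq> F T \<union> T" "F T \<subseteq> V" "sparse (F T)"
      by blast
    with I \<open>I \<subseteq> V\<close> show "\<exists>T. T \<subseteq> V \<and> card T \<le> s \<and> I \<in> G T"
      by (intro exI[of _ T]) (auto simp: G_def)
  next
    fix T assume T: "T \<subseteq> V" "card T \<le> s"
    have finT: "finite T" using T(1) V(1) by (rule finite_subset)
    show "real (card (G T)) \<le> w * \<rho> ^ card T"
    proof (cases "F T \<subseteq> V \<and> sparse (F T)")
      case False
      then have "G T = {}" by (auto simp: G_def)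
      then show ?thesis using pos by (simp add: w_def \<rho>_def)
    next
      case True
      have finF: "finite (F T)" using True V(1) finite_subset by blast
      have G: "T \<subseteq> I \<and> I \<subseteq> F T \<union> T \<and> card I = m" if "I \<in> G T" for I
        using that by (auto simp: G_def SF_ge_def SF_def)
      have T': "2 * card T \<le> m" "real (card T) \<le> \<delta> / 2 * real m" using T(2) s by auto
      from True dich[of "F T"] consider
          "real (card (F T)) + \<beta> * real ?n \<le> real ?N"
        | B where "B \<in> \<B>" "real (card (F T - B)) \<le> b0 * exp (- 4 / \<delta>) * real ?n" by blast
      then show ?thesis
      proof cases
        case 1
        have "real (card (G T)) \<le> exp (- \<beta> / 2 * real m) * \<rho> ^ card T * real (?N choose m)"
          unfolding \<rho>_def
          by (rule card_small_container_le[OF finF finT G pos(2,3,4) n fam_norm_le[OF V(1) \<B>] 1 m T'(1)])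
        then show ?thesis by (simp add: w_def ac_simps)
      next
        case 2
        have far: "\<delta> * real m \<le> real (card (I - B))" if "I \<in> G T" for I
          using that 2(1) by (auto simp: G_def SF_ge_def)
        have finB: "finite B" using 2(1) \<B> V(1) finite_subset by blast
        have "real (card (G T)) \<le> exp (- real m) * \<rho> ^ card T * real (?N choose m)"
          unfolding \<rho>_def
          by (rule card_structured_container_le[OF finF finT G far pos(1,4) n finB
                card_le_fam_norm[OF fin\<B> 2(1)] 2(2) m T'])
        also have "\<dots> \<le> exp (- \<beta> / 2 * real m) * \<rho> ^ card T * real (?N choose m)"
        proof -
          have "\<beta> / 2 * real m \<le> 1 * real m" using pos by (intro mult_right_mono) auto
          then show ?thesis using pos by (intro mult_right_mono) (auto simp: \<rho>_def)
        qed
        finally show ?thesis by (simp add: w_def ac_simps)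
      qed
    qed
  qed
  also have "real ?n * \<rho> = real m / b0" using n by (simp add: \<rho>_def)
  also have "w * (\<Sum>t\<le>s. (real m / b0) ^ t / fact t) \<le> w * exp (\<beta> / 4 * real m)"
    using sum by (intro mult_left_mono) (auto simp: w_def)
  also have "\<dots> = (exp (- \<beta> / 2 * real m) * exp (\<beta> / 4 * real m)) * real (?N choose m)"
    by (simp add: w_def)
  also have "exp (- \<beta> / 2 * real m) * exp (\<beta> / 4 * real m) = exp (- \<beta> / 4 * real m)"
    by (simp flip: exp_add)
  finally show ?thesis .
qed

text \<open>A member would be a large set without edges, so \<open>close\<close> puts all but
  \<open>\<gamma> * n\<close> of it inside some \<open>B\<close>, whereas at least
  \<open>\<delta> * \<kappa> * n\<close> of its elements must lie outside.\<close>

lemma SF_ge_eq_empty: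
  fixes \<delta> \<gamma> \<kappa> :: real
  assumes "0 \<le> \<delta>" and large: "\<kappa> * n \<le> real m" and \<gamma>: "\<gamma> < \<delta> * \<kappa>" and n: "0 < n"
    and close: "\<And>A. A \<subseteq> V \<Longrightarrow> \<kappa> * n \<le> real (card A) \<Longrightarrow> induced_edges E A = 0 \<Longrightarrow>
      \<exists>B\<in>\<B>. real (card (A - B)) \<le> \<gamma> * n"
  shows "SF_ge \<delta> V E \<B> m = {}"
proof (rule ccontr)
  assume "SF_ge \<delta> V E \<B> m \<noteq> {}"
  then obtain I where I: "I \<subseteq> V" "card I = m" "\<forall>e\<in>E. \<not> e \<subseteq> I"
      "\<And>B. B \<in> \<B> \<Longrightarrow> \<delta> * real m \<le> real (card (I - B))"
    by (auto simp: SF_ge_def SF_def)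
  have "{e \<in> E. e \<subseteq> I} = {}" using I(3) by blast
  then have "induced_edges E I = 0" by (simp only: induced_edges_def card.empty)
  then obtain B where "B \<in> \<B>" "real (card (I - B)) \<le> \<gamma> * n"
    using close[of I] I(1,2) large by auto
  then have "\<delta> * real m \<le> \<gamma> * n" using I(4) by force
  moreover have "\<delta> * (\<kappa> * n) \<le> \<delta> * real m" using large assms(1) by (rule mult_left_mono)
  moreover have "\<gamma> * n < (\<delta> * \<kappa>) * n" using \<gamma> n by (rule mult_strict_right_mono)
  ultimately show False by (simp add: mult.assoc)
qed

text \<open>Decreasing the constant only strengthens both premises, the size bound and the sparsity
  bound, so it may be capped by any \<open>u > 0\<close>.\<close>

lemma stableE:
  assumes "stable \<alpha> V E \<B>" "0 < \<gamma>" "0 < u"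
  obtains \<beta> where "0 < \<beta>" "\<beta> \<le> u"
    "\<forall>n. \<forall>A\<subseteq>V n. (\<alpha> - \<beta>) * real n \<le> real (card A) \<longrightarrow>
       real (induced_edges (E n) A) < \<beta> * real (card (E n)) \<longrightarrow>
       (\<exists>B\<in>\<B> n. real (card (A - B)) \<le> \<gamma> * real n)"
proof -
  from assms obtain \<beta>' where \<beta>': "0 < \<beta>'" "\<And>n A. A \<subseteq> V n \<and> (\<alpha> - \<beta>') * real n \<le> real (card A) \<longrightarrow>
        \<beta>' * real (card (E n)) \<le> real (induced_edges (E n) A)
      \<or> (\<exists>B\<in>\<B> n. real (card (A - B)) \<le> \<gamma> * real n)"
    unfolding stable_def by blast
  show ?thesis
  proof (rule that[of "min \<beta>' u"], safe)
    fix n A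
    assume A: "A \<subseteq> V n" "(\<alpha> - min \<beta>' u) * real n \<le> real (card A)"
      "real (induced_edges (E n) A) < min \<beta>' u * real (card (E n))"
    have "(\<alpha> - \<beta>') * real n \<le> (\<alpha> - min \<beta>' u) * real n" by (intro mult_right_mono) auto
    moreover have "min \<beta>' u * real (card (E n)) \<le> \<beta>' * real (card (E n))" by (intro mult_right_mono) auto
    ultimately show "\<exists>B\<in>\<B> n. real (card (A - B)) \<le> \<gamma> * real n"
      using \<beta>'(2)[of A n] A by linarith
  qed (use \<beta>'(1) assms(3) in auto)
qed

theorem theorem4p1:
  fixes \<alpha> :: real and V :: "nat \<Rightarrow> 'a set" and E :: "nat \<Rightarrow> 'a set set"
    and \<B> :: "nat \<Rightarrow> 'a set set"
  assumes "\<alpha> > 0"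
    and "\<And>n. uniform3 (V n) (E n)"
    and "\<And>n. card (V n) = n"
    and "\<And>n. \<B> n \<subseteq> Pow (V n)"
    and "stable \<alpha> V E \<B>"
    and "(\<lambda>n. real (card (E n))) \<in> \<Theta>(\<lambda>n. real n ^ 2)"
    and "(\<lambda>n. real (Delta2 (V n) (E n))) \<in> O(\<lambda>_. 1)"
    and "\<And>n. real (fam_norm (\<B> n)) \<ge> \<alpha> * real n"
  shows "\<forall>\<delta>>0. \<exists>C>0. \<exists>\<epsilon>>0. \<exists>N. \<forall>n\<ge>N. \<forall>m::nat. real m \<ge> C * sqrt (real n) \<longrightarrow>
           real (card (SF_ge \<delta> (V n) (E n) (\<B> n) m))
             \<le> (2 powr (- \<epsilon> * real m) + \<delta> ^ m * real (card (\<B> n)))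
                 * real (fam_norm (\<B> n) choose m)"
proof (intro allI impI)
  fix \<delta> :: real assume \<delta>: "\<delta> > 0"
  \<comment> \<open>First use of stability, for large \<open>m\<close>. The cap
    \<open>\<alpha> / 2\<close> gives
    \<open>\<delta> * \<alpha> / 4 < \<delta> * (\<alpha> - b0)\<close>. For smaller
    \<open>m\<close> the same \<open>b0\<close> measures the gap between \<open>m\<close> and the
    norm of the family.\<close>
  from \<open>\<alpha> > 0\<close> \<delta> have "0 < \<delta> * \<alpha> / 4" "0 < \<alpha> / 2" by auto
  with assms(5) obtain b0 where b0: "0 < b0" "b0 \<le> \<alpha> / 2"
    "\<forall>n. \<forall>A\<subseteq>V n. (\<alpha> - b0) * real n \<le> real (card A) \<longrightarrow>
       real (induced_edges (E n) A) < b0 * real (card (E n)) \<longrightarrow>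
       (\<exists>B\<in>\<B> n. real (card (A - B)) \<le> \<delta> * \<alpha> / 4 * real n)"
    by (rule stableE)
  \<comment> \<open>Second use of stability, for containers; its tolerance depends on
    \<open>b0\<close>, so \<open>b0\<close> had to be fixed first.\<close>
  have "0 < b0 * exp (- 4 / \<delta>)" using b0(1) by simp
  with assms(5) obtain \<beta> where \<beta>: "0 < \<beta>" "\<beta> \<le> 1"
    "\<forall>n. \<forall>A\<subseteq>V n. (\<alpha> - \<beta>) * real n \<le> real (card A) \<longrightarrow>
       real (induced_edges (E n) A) < \<beta> * real (card (E n)) \<longrightarrow>
       (\<exists>B\<in>\<B> n. real (card (A - B)) \<le> b0 * exp (- 4 / \<delta>) * real n)"
    by (rule stableE[where u = 1]) simp
  from bigthetaD2[OF assms(6)] obtain c1 where c1: "c1 > 0"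
    "eventually (\<lambda>n. c1 * norm (real n ^ 2) \<le> norm (real (card (E n)))) at_top"
    by (rule landau_omega.bigE)
  from assms(7) obtain d where d: "d > 0"
    "eventually (\<lambda>n. norm (real (Delta2 (V n) (E n))) \<le> d * norm (1 :: real)) at_top"
    by (rule landau_o.bigE)
  define D where "D = nat \<lceil>d\<rceil>"
  have D: "0 < D" "d \<le> real D" unfolding D_def using d(1) by (auto simp: real_nat_ceiling_ge)
  have "eventually (\<lambda>n. c1 * real n ^ 2 \<le> real (card (E n)) \<and> Delta2 (V n) (E n) \<le> D) at_top"
    using c1(2) d(2) by eventually_elim (use D(2) in auto)
  then obtain N0 where N0: "\<And>n. N0 \<le> n \<Longrightarrow> c1 * real n ^ 2 \<le> real (card (E n)) \<and> Delta2 (V n) (E n) \<le> D"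
    by (auto simp: eventually_at_top_linorder)
  \<comment> \<open>This density makes containers sparse relative to \<open>card (E n)\<close>,
    which is at least \<open>c1 * n^2\<close>.\<close>
  have "0 < \<beta> * c1" using \<beta>(1) c1(1) by simp
  from hypergraph_containers[OF this D(1), where 'a = 'a] obtain K where K: "K > 0"
    "\<And>(V :: 'a set) E. uniform3 V E \<and> Delta2 V E \<le> D \<and> V \<noteq> {} \<Longrightarrow>
    (\<exists>F s. real s \<le> K * sqrt (real (card V)) \<and>
      (\<forall>I. I \<subseteq> V \<and> (\<forall>e\<in>E. \<not> e \<subseteq> I) \<longrightarrow> (\<exists>T. T \<subseteq> I \<and> card T \<le> s \<and> I \<subseteq> F T \<union> T \<and>
         F T \<subseteq> V \<and> real (induced_edges E (F T)) < \<beta> * c1 * (real (card V))\<^sup>2)))"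
    by metis
  from sum_initial_le_exp[OF b0(1), of "\<beta> / 4"] \<beta>(1) obtain \<eta>' where \<eta>': "\<eta>' > 0"
    "\<And>m s. real s \<le> \<eta>' * real m \<Longrightarrow> (\<Sum>t\<le>s. (real m / b0) ^ t / fact t) \<le> exp (\<beta> / 4 * real m)"
    by auto
  \<comment> \<open>The three bounds control the sum over fingerprints, keep
    \<open>2 * s \<le> m\<close>, and keep at least \<open>\<delta> * m / 2\<close> elements outside
    \<open>B\<close> after removing \<open>T\<close>.\<close>
  define \<eta> where "\<eta> = min \<eta>' (min (1 / 2) (\<delta> / 2))"
  have \<eta>: "\<eta> > 0" "\<eta> \<le> \<eta>'" "\<eta> \<le> 1 / 2" "\<eta> \<le> \<delta> / 2" using \<eta>' \<delta> by (auto simp: \<eta>_def)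
  show "\<exists>C>0. \<exists>\<epsilon>>0. \<exists>N. \<forall>n\<ge>N. \<forall>m::nat. real m \<ge> C * sqrt (real n) \<longrightarrow>
           real (card (SF_ge \<delta> (V n) (E n) (\<B> n) m))
             \<le> (2 powr (- \<epsilon> * real m) + \<delta> ^ m * real (card (\<B> n)))
                 * real (fam_norm (\<B> n) choose m)"
  proof (intro exI conjI allI impI)
    \<comment> \<open>With \<open>C = K / \<eta>\<close> the fingerprint size, at most
      \<open>K * sqrt n\<close>, is at most \<open>\<eta> * m\<close>; the exponent is
      \<open>\<epsilon> = \<beta> / 4\<close>.\<close>
    show "K / \<eta> > 0" "\<beta> / 4 > 0" using K(1) \<eta>(1) \<beta>(1) by auto
    fix n m assume n: "max N0 1 \<le> n" and Cm: "K / \<eta> * sqrt (real n) \<le> real m"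
    have V: "finite (V n)" "V n \<noteq> {}"
      using assms(3)[of n] n uniform3_finite(1)[OF assms(2)] by auto
    have E: "c1 * real n ^ 2 \<le> real (card (E n))" "Delta2 (V n) (E n) \<le> D" using N0[of n] n by auto
    \<comment> \<open>Positivity lets a set without edges satisfy the strict sparsity bound of
      stability.\<close>
    have Epos: "0 < real (card (E n))"
    proof -
      have "0 < c1 * real n ^ 2" using c1(1) n by simp
      then show ?thesis using E(1) by linarith
    qed
    have "real (card (SF_ge \<delta> (V n) (E n) (\<B> n) m)) \<le> exp (- \<beta> / 4 * real m) * real (fam_norm (\<B> n) choose m)"
    proof (cases "(\<alpha> - b0) * real n \<le> real m")
      case True
      have "SF_ge \<delta> (V n) (E n) (\<B> n) m = {}"
      proof (rule SF_ge_eq_empty[OF _ True])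
        have "\<delta> * (\<alpha> / 2) \<le> \<delta> * (\<alpha> - b0)" using b0(2) \<delta> by (intro mult_left_mono) auto
        moreover have "0 < \<delta> * \<alpha>" using \<delta> \<open>\<alpha> > 0\<close> by simp
        ultimately show "\<delta> * \<alpha> / 4 < \<delta> * (\<alpha> - b0)" by simp
        fix A assume "A \<subseteq> V n" "(\<alpha> - b0) * real n \<le> real (card A)" "induced_edges (E n) A = 0"
        then show "\<exists>B\<in>\<B> n. real (card (A - B)) \<le> \<delta> * \<alpha> / 4 * real n"
          using b0(1) Epos by (intro b0(3)[rule_format]) auto
      qed (use \<delta> n in auto)
      then show ?thesis by simp
    next
      case False
      have "uniform3 (V n) (E n) \<and> Delta2 (V n) (E n) \<le> D \<and> V n \<noteq> {}" using assms(2) E(2) V by auto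
      from K(2)[OF this] obtain F s where s: "real s \<le> K * sqrt (real n)"
        and F: "\<forall>I. I \<subseteq> V n \<and> (\<forall>e\<in>E n. \<not> e \<subseteq> I) \<longrightarrow> (\<exists>T. T \<subseteq> I \<and> card T \<le> s \<and> I \<subseteq> F T \<union> T \<and>
         F T \<subseteq> V n \<and> real (induced_edges (E n) (F T)) < \<beta> * c1 * (real n)\<^sup>2)"
        unfolding assms(3) by blast
      have "K * sqrt (real n) \<le> \<eta> * real m" using Cm \<eta>(1) by (simp add: field_simps)
      then have s\<eta>: "real s \<le> \<eta> * real m" using s by linarith
      have s_le: "real s \<le> u * real m" if "\<eta> \<le> u" for u
        using s\<eta> mult_right_mono[OF that, of "real m"] by simp
      show ?thesis
      proof (rule card_SF_ge_le[OF V assms(4) \<delta> \<beta>(1,2) b0(1) _ s_le[OF \<eta>(4)] F[rule_format, OF conjI]])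
        show "2 * s \<le> m" using s_le[OF \<eta>(3)] by simp
        show "(\<Sum>t\<le>s. (real m / b0) ^ t / fact t) \<le> exp (\<beta> / 4 * real m)"
          using \<eta>'(2) s_le[OF \<eta>(2)] by blast
        show "real m + b0 * real (card (V n)) \<le> real (fam_norm (\<B> n))"
          using False assms(8)[of n] by (simp add: assms(3) algebra_simps)
        fix C assume C: "C \<subseteq> V n" "real (induced_edges (E n) C) < \<beta> * c1 * (real n)\<^sup>2"
        have "\<beta> * (c1 * (real n)\<^sup>2) \<le> \<beta> * real (card (E n))" using E(1) \<beta>(1) by (intro mult_left_mono) auto
        then have sparse: "real (induced_edges (E n) C) < \<beta> * real (card (E n))"
          using C(2) by (simp add: mult.assoc)
        show "real (card C) + \<beta> * real (card (V n)) \<le> real (fam_norm (\<B> n))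
          \<or> (\<exists>B\<in>\<B> n. real (card (C - B)) \<le> b0 * exp (- 4 / \<delta>) * real (card (V n)))"
        \<comment> \<open>A container below this size is short of the norm, which is at least
          \<open>\<alpha> * n\<close>, by \<open>\<beta> * n\<close>; a larger one falls under
          stability.\<close>
        proof (cases "(\<alpha> - \<beta>) * real n \<le> real (card C)")
          case True
          from \<beta>(3)[rule_format, OF C(1) True sparse] show ?thesis by (simp add: assms(3))
        next
          case False
          then show ?thesis using assms(8)[of n] by (simp add: assms(3) algebra_simps)
        qed
      qed
    qed
    also have "\<dots> \<le> (2 powr (- (\<beta> / 4) * real m) + \<delta> ^ m * real (card (\<B> n))) * real (fam_norm (\<B> n) choose m)"
    proof (rule mult_right_mono)
      \<comment> \<open>Passing from base e to base 2 weakens the bound because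
        \<open>ln 2 < 1\<close>.\<close>
      have "\<beta> / 4 * real m * ln 2 \<le> \<beta> / 4 * real m * 1"
        using \<beta>(1) ln_2_less_1 by (intro mult_left_mono) auto
      then have "exp (- \<beta> / 4 * real m) \<le> 2 powr (- (\<beta> / 4) * real m)"
        by (simp add: powr_def)
      moreover have "0 \<le> \<delta> ^ m * real (card (\<B> n))" using \<delta> by simp
      ultimately show "exp (- \<beta> / 4 * real m) \<le> 2 powr (- (\<beta> / 4) * real m) + \<delta> ^ m * real (card (\<B> n))"
        by linarith
    qed simp
    finally show "real (card (SF_ge \<delta> (V n) (E n) (\<B> n) m))
        \<le> (2 powr (- (\<beta> / 4) * real m) + \<delta> ^ m * real (card (\<B> n))) * real (fam_norm (\<B> n) choose m)" .
  qed
qed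

end
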